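(* Let $A,B,C\in\mathbb{R}[x]$ be polynomials. For $N\ge 3$ let $W_N\subset\mathbb{R}^N$ be the set of all finite sequences $(u_0,\dots,u_{N-1})$ of real numbers such that for every integer $j$ with $0\le j\le N-3$ the minimum $$\min\{u_j+A(j),\ u_{j+1}+B(j),\ u_{j+2}+C(j)\}$$ is attained at least twice, i.e. for at least two of the three terms. Then the limit $H:=\lim_{N\to\infty}\dim(W_N)/N$ exists, and: 1) if $A(i)+C(i-1)=B(i-1)+B(i)$ for all $i$, then $H=1/3$; 2) if $A(i)+C(i-1)<B(i-1)+B(i)$ for all sufficiently large $i$, and $A(i+1)-A(i)+C(i)-C(i-1)=B(i+1)-B(i-1)$ for all $i$, then $H=1/4$; 3) in all other cases, $H=0$.
   Context: The set $W_N$ is a tropical prevariety, i.e. a finite union of closed convex polyhedra in $\mathbb{R}^N$; $\dim(W_N)$ denotes the maximum of the dimensions of these polyhedra (the dimension of a polyhedron being that of its affine hull). Strict inequalities between polynomials are understood to hold for all sufficiently large integer arguments, and equalities between polynomials are identities. The number $H$ is called the tropical entropy of the vector $(A,B,C)$; in general it is defined as $\limsup_{N\to\infty}\dim(W_N)/N$. *)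

theory Defs
  imports "HOL-Analysis.Analysis" "HOL-Analysis.Finite_Function_Topology"
    "HOL-Computational_Algebra.Polynomial"
begin

text \<open>
  Since \<open>N\<close> tends to infinity, \<open>\<real>\<^sup>N\<close> cannot be a type depending on \<open>N\<close>.  A vector
  \<open>(u\<^sub>0, \<dots>, u\<^bsub>N-1\<^esub>)\<close> is represented by the function \<open>nat \<Rightarrow>\<^sub>0 real\<close> with these values that
  vanishes at all \<open>i \<ge> N\<close>.  This type is an instance of class \<open>real_vector\<close>, so the library's
  \<open>affine hull\<close> and \<open>dim\<close> apply (but not \<open>polyhedron\<close> and \<open>aff_dim\<close>, which need a Euclidean space).
\<close>

definition coord_space :: "nat \<Rightarrow> (nat \<Rightarrow>\<^sub>0 real) set" where
  "coord_space N = {u. Poly_Mapping.keys u \<subseteq> {..<N}}"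

definition is_polyhedron :: "nat \<Rightarrow> (nat \<Rightarrow>\<^sub>0 real) set \<Rightarrow> bool" where
  "is_polyhedron N P \<longleftrightarrow>
     (\<exists>F :: ((nat \<Rightarrow> real) \<times> real) set. finite F \<and>
        P = {u \<in> coord_space N. \<forall>(a, b) \<in> F. (\<Sum>i<N. a i * Poly_Mapping.lookup u i) \<le> b})"

text \<open>The dimension of an affine space is the dimension of its space of directions.
  The empty polyhedron gets dimension \<open>0\<close>.\<close>

definition directions :: "'a::real_vector set \<Rightarrow> 'a set" where
  "directions P = {x - y | x y. x \<in> affine hull P \<and> y \<in> affine hull P}"

definition polyhedron_dim :: "'a::real_vector set \<Rightarrow> nat" where
  "polyhedron_dim P = dim (directions P)"

definition polyhedral_decomposition ::
    "nat \<Rightarrow> (nat \<Rightarrow>\<^sub>0 real) set \<Rightarrow> (nat \<Rightarrow>\<^sub>0 real) set set \<Rightarrow> bool" where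
  "polyhedral_decomposition N W F \<longleftrightarrow>
     finite F \<and> F \<noteq> {} \<and> (\<forall>P\<in>F. is_polyhedron N P) \<and> W = \<Union>F"

text \<open>Independence of the decomposition is shown in \<open>prevariety_dim_eq\<close> below.\<close>

definition prevariety_dim :: "nat \<Rightarrow> (nat \<Rightarrow>\<^sub>0 real) set \<Rightarrow> nat" where
  "prevariety_dim N W =
     (THE d. \<exists>F. polyhedral_decomposition N W F \<and> d = Max (polyhedron_dim ` F))"

definition min_attained_twice :: "real \<Rightarrow> real \<Rightarrow> real \<Rightarrow> bool" where
  "min_attained_twice x y z \<longleftrightarrow>
     (let m = Min {x, y, z} in (x = m \<and> y = m) \<or> (x = m \<and> z = m) \<or> (y = m \<and> z = m))"

definition tropical_solutions ::
    "real poly \<Rightarrow> real poly \<Rightarrow> real poly \<Rightarrow> nat \<Rightarrow> (nat \<Rightarrow>\<^sub>0 real) set" where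
  "tropical_solutions A B C N =
     {u \<in> coord_space N. \<forall>j. j + 3 \<le> N \<longrightarrow>
        min_attained_twice
          (Poly_Mapping.lookup u j + poly A (real j))
          (Poly_Mapping.lookup u (j + 1) + poly B (real j))
          (Poly_Mapping.lookup u (j + 2) + poly C (real j))}"


subsection \<open>The dimension does not depend on the decomposition\<close>

lemma lookup_scaleR: "Poly_Mapping.lookup (c *\<^sub>R u) i = c * Poly_Mapping.lookup u i"
  for u :: "'a \<Rightarrow>\<^sub>0 real"
  by (simp add: scaleR_poly_mapping_def)

lemma coord_space_iff: "u \<in> coord_space N \<longleftrightarrow> (\<forall>i\<ge>N. Poly_Mapping.lookup u i = 0)"
  by (simp add: coord_space_def subset_iff in_keys_iff) (meson not_le)

lemma subspace_coord_space: "subspace (coord_space N)"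
  unfolding subspace_def by (simp add: coord_space_iff lookup_add lookup_scaleR)

lemma coord_space_subset_span:
  "coord_space N \<subseteq> span ((\<lambda>i. Poly_Mapping.single i (1::real)) ` {..<N})"
proof
  fix u assume u: "u \<in> coord_space N"
  have "u = (\<Sum>i<N. Poly_Mapping.lookup u i *\<^sub>R Poly_Mapping.single i 1)"
  proof (rule poly_mapping_eqI)
    fix k
    have "(\<Sum>i<N. Poly_Mapping.lookup u i * Poly_Mapping.lookup (Poly_Mapping.single i 1) k)
        = (\<Sum>i<N. if i = k then Poly_Mapping.lookup u k else 0)"
      by (rule sum.cong) (auto simp: lookup_single when_def)
    then show "Poly_Mapping.lookup u k =
        Poly_Mapping.lookup (\<Sum>i<N. Poly_Mapping.lookup u i *\<^sub>R Poly_Mapping.single i 1) k"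
      using u by (auto simp: lookup_sum lookup_scaleR coord_space_iff)
  qed
  also have "\<dots> \<in> span ((\<lambda>i. Poly_Mapping.single i (1::real)) ` {..<N})"
    by (intro span_sum span_scale span_base) auto
  finally show "u \<in> span ((\<lambda>i. Poly_Mapping.single i (1::real)) ` {..<N})" .
qed

lemma is_polyhedron_subset: "is_polyhedron N P \<Longrightarrow> P \<subseteq> coord_space N"
  unfolding is_polyhedron_def by blast

lemma is_polyhedron_convex:
  assumes "is_polyhedron N P"
  shows "convex P"
proof -
  from assms obtain F :: "((nat \<Rightarrow> real) \<times> real) set" where
    P: "P = {u \<in> coord_space N. \<forall>(a, b) \<in> F. (\<Sum>i<N. a i * Poly_Mapping.lookup u i) \<le> b}"
    unfolding is_polyhedron_def by blast
  show ?thesis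
  proof (rule convexI)
    fix x y and s t :: real
    assume xy: "x \<in> P" "y \<in> P" and st: "0 \<le> s" "0 \<le> t" "s + t = 1"
    have "s *\<^sub>R x + t *\<^sub>R y \<in> coord_space N"
      using xy subspace_coord_space unfolding P
      by (auto intro: subspace_add subspace_scale)
    moreover have "(\<Sum>i<N. a i * Poly_Mapping.lookup (s *\<^sub>R x + t *\<^sub>R y) i) \<le> b" if "(a, b) \<in> F" for a b
    proof -
      have "(\<Sum>i<N. a i * Poly_Mapping.lookup (s *\<^sub>R x + t *\<^sub>R y) i) =
          s * (\<Sum>i<N. a i * Poly_Mapping.lookup x i) + t * (\<Sum>i<N. a i * Poly_Mapping.lookup y i)"
        by (simp add: lookup_add lookup_scaleR sum_distrib_left sum.distrib algebra_simps)
      also have "\<dots> \<le> s * b + t * b"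
        using xy that st unfolding P by (intro add_mono mult_left_mono) auto
      also have "\<dots> = b" using st by (metis distrib_right mult_1)
      finally show ?thesis .
    qed
    ultimately show "s *\<^sub>R x + t *\<^sub>R y \<in> P" unfolding P by auto
  qed
qed

lemma finite_all_eq: "finite S" if "\<forall>s\<in>S. \<forall>t\<in>S. s = t"
proof (cases "S = {}")
  case False
  then obtain s where "s \<in> S" by blast
  with that have "S \<subseteq> {s}" by blast
  then show ?thesis by (rule finite_subset) simp
qed simp

lemma convex_subset_finite_Union_affine:
  fixes P :: "'a::real_vector set"
  assumes "finite \<T>" "convex P" "P \<noteq> {}" "P \<subseteq> \<Union>\<T>" "\<forall>T\<in>\<T>. affine T"
  shows "\<exists>T\<in>\<T>. P \<subseteq> T"
  using assms
proof (induction \<T>)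
  case empty
  then show ?case by simp
next
  case (insert T \<T>)
  have two: "y \<in> U \<and> x \<in> U"
    if U: "affine U" and st: "s \<noteq> t" "(1 - s) *\<^sub>R y + s *\<^sub>R x \<in> U" "(1 - t) *\<^sub>R y + t *\<^sub>R x \<in> U"
    for U and x y :: 'a and s t :: real
  proof -
    let ?p = "(1 - s) *\<^sub>R y + s *\<^sub>R x" and ?q = "(1 - t) *\<^sub>R y + t *\<^sub>R x"
    have gen: "(1 - r) *\<^sub>R y + r *\<^sub>R x \<in> U" for r
    proof -
      define c where "c = (r - s) / (t - s)"
      have "c * (t - s) = r - s" using st(1) by (simp add: c_def)
      then have c: "(1 - c) * s + c * t = r" by (simp add: algebra_simps)
      have "(1 - c) *\<^sub>R ?p + c *\<^sub>R ?q
          = (1 - ((1 - c) * s + c * t)) *\<^sub>R y + ((1 - c) * s + c * t) *\<^sub>R x"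
        by (simp add: algebra_simps)
      moreover have "(1 - c) *\<^sub>R ?p + c *\<^sub>R ?q \<in> U"
        using U st unfolding affine_alt by blast
      ultimately show ?thesis unfolding c by simp
    qed
    from gen[of 0] gen[of 1] show ?thesis by simp
  qed
  show ?case
  proof (cases "P \<subseteq> T")
    case True
    then show ?thesis by blast
  next
    case False
    then obtain x where x: "x \<in> P" "x \<notin> T" by blast
    have "y \<in> \<Union>\<T>" if y: "y \<in> P" for y
    proof -
      define g where "g t = (1 - t) *\<^sub>R y + t *\<^sub>R x" for t :: real
      define I where "I U = {t \<in> {0..1}. g t \<in> U}" for U
      have "g t \<in> P" if "t \<in> {0..1}" for t
        using insert.prems(1) x y that unfolding g_def convex_alt by auto
      then have "g t \<in> \<Union>(insert T \<T>)" if "t \<in> {0..1}" for t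
        using insert.prems(3) that by blast
      then have "t \<in> I T \<union> (\<Union>U\<in>\<T>. I U)" if "t \<in> {0..1}" for t
        using that unfolding I_def by blast
      then have cover: "{0..1} = I T \<union> (\<Union>U\<in>\<T>. I U)"
        unfolding I_def by blast
      have line: "y \<in> U \<and> x \<in> U" if "U \<in> insert T \<T>" "s \<in> I U" "t \<in> I U" "s \<noteq> t" for U s t
        using two[of U s t y x] insert.prems(4) that by (simp add: I_def g_def, blast)
      have "\<forall>s\<in>I T. \<forall>t\<in>I T. s = t"
        using line[of T] x(2) by blast
      then have "finite (I T)"
        by (rule finite_all_eq)
      moreover have "infinite {0..1::real}" by (simp add: infinite_Icc)
      ultimately have "infinite (\<Union>U\<in>\<T>. I U)" unfolding cover by simp
      then obtain U where U: "U \<in> \<T>" "infinite (I U)" using insert.hyps(1) by blast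
      then obtain s t where "s \<in> I U" "t \<in> I U" "s \<noteq> t"
        using finite_all_eq[of "I U"] by blast
      then have "y \<in> U"
        using line[of U s t] U(1) by simp
      then show ?thesis using U by blast
    qed
    then have "P \<subseteq> \<Union>\<T>" by (rule subsetI)
    then have "\<exists>T\<in>\<T>. P \<subseteq> T"
      using insert.IH insert.prems by simp
    then show ?thesis by blast
  qed
qed

lemma polyhedron_dim_mono:
  assumes "P \<subseteq> affine hull Q" "Q \<subseteq> coord_space N"
  shows "polyhedron_dim P \<le> polyhedron_dim Q"
proof -
  have "affine hull P \<subseteq> affine hull Q"
    using assms(1) by (simp add: hull_minimal)
  then have sub: "directions P \<subseteq> directions Q" unfolding directions_def by blast
  have "affine hull Q \<subseteq> coord_space N"
    using assms(2) by (intro hull_minimal subspace_imp_affine subspace_coord_space)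
  then have QN: "directions Q \<subseteq> coord_space N"
    unfolding directions_def using subspace_diff[OF subspace_coord_space] by blast
  obtain B where B: "B \<subseteq> directions P" "independent B" "card B = dim (directions P)"
    by (metis basis_exists)
  obtain D where D: "D \<subseteq> directions Q" "independent D" "directions Q \<subseteq> span D"
    "card D = dim (directions Q)"
    by (metis basis_exists)
  have "finite D"
    using independent_span_bound[of "(\<lambda>i. Poly_Mapping.single i (1::real)) ` {..<N}" D]
      D QN coord_space_subset_span[of N] by auto
  then have "card B \<le> card D"
    using independent_span_bound[of D B] B D sub by auto
  then show ?thesis using B D by (simp add: polyhedron_dim_def)
qed

lemma Max_polyhedron_dim_le:
  assumes "polyhedral_decomposition N W F" "polyhedral_decomposition N W G"
  shows "Max (polyhedron_dim ` F) \<le> Max (polyhedron_dim ` G)"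
proof -
  have F: "finite F" "F \<noteq> {}" "\<And>P. P \<in> F \<Longrightarrow> is_polyhedron N P"
    and G: "finite G" "G \<noteq> {}" "\<And>Q. Q \<in> G \<Longrightarrow> is_polyhedron N Q"
    and W: "\<Union>F = \<Union>G"
    using assms unfolding polyhedral_decomposition_def by auto
  have "polyhedron_dim P \<le> Max (polyhedron_dim ` G)" if P: "P \<in> F" for P
  proof -
    have "\<exists>Q\<in>G. P \<subseteq> affine hull Q"
    proof (cases "P = {}")
      case True
      then show ?thesis using G(2) by blast
    next
      case False
      have "P \<subseteq> \<Union>((\<lambda>Q. affine hull Q) ` G)"
      proof
        fix x assume "x \<in> P"
        then obtain Q where "Q \<in> G" "x \<in> Q" using P W by blast
        then show "x \<in> \<Union>((\<lambda>Q. affine hull Q) ` G)" by (auto intro: hull_inc)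
      qed
      then show ?thesis
        using convex_subset_finite_Union_affine[of "(\<lambda>Q. affine hull Q) ` G" P]
          G(1) is_polyhedron_convex[OF F(3)[OF P]] False by auto
    qed
    then obtain Q where Q: "Q \<in> G" "P \<subseteq> affine hull Q" by blast
    then have "polyhedron_dim P \<le> polyhedron_dim Q"
      using polyhedron_dim_mono is_polyhedron_subset G(3) by blast
    also have "\<dots> \<le> Max (polyhedron_dim ` G)" using G(1) Q(1) by simp
    finally show ?thesis .
  qed
  then show ?thesis using F(1,2) by simp
qed

lemma prevariety_dim_eq:
  assumes "polyhedral_decomposition N W F"
  shows "prevariety_dim N W = Max (polyhedron_dim ` F)"
  unfolding prevariety_dim_def
  using assms Max_polyhedron_dim_le by (intro the_equality) (blast intro: antisym)+


subsection \<open>The solution sets are tropical prevarieties\<close>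

lemma is_polyhedron_coord_space: "is_polyhedron N (coord_space N)"
  unfolding is_polyhedron_def by (rule exI[of _ "{}"]) auto

lemma is_polyhedron_Int:
  assumes "is_polyhedron N P" "is_polyhedron N Q"
  shows "is_polyhedron N (P \<inter> Q)"
proof -
  from assms obtain F G :: "((nat \<Rightarrow> real) \<times> real) set" where
    "finite F" "P = {u \<in> coord_space N. \<forall>(a, b) \<in> F. (\<Sum>i<N. a i * Poly_Mapping.lookup u i) \<le> b}"
    "finite G" "Q = {u \<in> coord_space N. \<forall>(a, b) \<in> G. (\<Sum>i<N. a i * Poly_Mapping.lookup u i) \<le> b}"
    unfolding is_polyhedron_def by blast
  then show ?thesis
    unfolding is_polyhedron_def by (intro exI[of _ "F \<union> G"]) auto
qed

lemma is_polyhedron_le: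
  assumes "p < N" "q < N"
  shows "is_polyhedron N {u \<in> coord_space N.
    Poly_Mapping.lookup u p + c \<le> Poly_Mapping.lookup u q + d}"
proof -
  define a :: "nat \<Rightarrow> real" where "a i = of_bool (i = p) - of_bool (i = q)" for i
  have "(\<Sum>i<N. a i * Poly_Mapping.lookup u i) =
      Poly_Mapping.lookup u p - Poly_Mapping.lookup u q" for u :: "nat \<Rightarrow>\<^sub>0 real"
    using assms by (simp add: a_def left_diff_distrib sum_subtractf of_bool_def if_distrib[of "\<lambda>x. x * _"] cong: if_cong)
  then show ?thesis
    unfolding is_polyhedron_def by (intro exI[of _ "{(a, d - c)}"]) auto
qed

lemma decomposition_Int:
  assumes "polyhedral_decomposition N V F" "polyhedral_decomposition N W G"
  shows "polyhedral_decomposition N (V \<inter> W) ((\<lambda>(P, Q). P \<inter> Q) ` (F \<times> G))"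
  unfolding polyhedral_decomposition_def
proof (intro conjI)
  show "V \<inter> W = \<Union>((\<lambda>(P, Q). P \<inter> Q) ` (F \<times> G))"
    using assms unfolding polyhedral_decomposition_def by auto
qed (use assms in \<open>auto simp: polyhedral_decomposition_def intro: is_polyhedron_Int\<close>)

lemma decomposition_min_attained_twice:
  assumes "p < N" "q < N" "r < N"
  shows "\<exists>F. polyhedral_decomposition N {u \<in> coord_space N.
    min_attained_twice (Poly_Mapping.lookup u p + a) (Poly_Mapping.lookup u q + b)
      (Poly_Mapping.lookup u r + c)} F"
proof -
  define L where "L i s j t =
    {u \<in> coord_space N. Poly_Mapping.lookup u i + s \<le> Poly_Mapping.lookup u j + t}" for i s j t
  have L: "is_polyhedron N (L i s j t)" if "i < N" "j < N" for i s j t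
    unfolding L_def using that by (rule is_polyhedron_le)
  let ?F = "{L p a q b \<inter> L q b p a \<inter> L p a r c, L p a r c \<inter> L r c p a \<inter> L p a q b,
     L q b r c \<inter> L r c q b \<inter> L q b p a}"
  have poly: "is_polyhedron N P" if "P \<in> ?F" for P
    using that assms L is_polyhedron_Int by (elim insertE emptyE) simp_all
  have twice: "min_attained_twice x y z \<longleftrightarrow>
      x \<le> y \<and> y \<le> x \<and> x \<le> z \<or> x \<le> z \<and> z \<le> x \<and> x \<le> y \<or> y \<le> z \<and> z \<le> y \<and> y \<le> x" for x y z
    by (auto simp: min_attained_twice_def Let_def min_def)
  have union: "{u \<in> coord_space N.
    min_attained_twice (Poly_Mapping.lookup u p + a) (Poly_Mapping.lookup u q + b)
      (Poly_Mapping.lookup u r + c)} = \<Union>?F"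
    unfolding L_def twice by blast
  have "polyhedral_decomposition N {u \<in> coord_space N.
    min_attained_twice (Poly_Mapping.lookup u p + a) (Poly_Mapping.lookup u q + b)
      (Poly_Mapping.lookup u r + c)} ?F"
    unfolding polyhedral_decomposition_def union
    by (intro conjI ballI refl poly) simp_all
  then show ?thesis by blast
qed

lemma decomposition_tropical_solutions:
  "\<exists>F. polyhedral_decomposition N (tropical_solutions A B C N) F"
proof -
  define S where "S j = {u \<in> coord_space N. min_attained_twice
          (Poly_Mapping.lookup u j + poly A (real j))
          (Poly_Mapping.lookup u (j + 1) + poly B (real j))
          (Poly_Mapping.lookup u (j + 2) + poly C (real j))}" for j
  have dec: "\<exists>F. polyhedral_decomposition N (coord_space N \<inter> (\<Inter>j\<in>{j. j < n \<and> j + 3 \<le> N}. S j)) F" for n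
  proof (induction n)
    case 0
    have "polyhedral_decomposition N (coord_space N) {coord_space N}"
      by (simp add: polyhedral_decomposition_def is_polyhedron_coord_space)
    then show ?case by auto
  next
    case (Suc n)
    show ?case
    proof (cases "n + 3 \<le> N")
      case True
      then have "{j. j < Suc n \<and> j + 3 \<le> N} = insert n {j. j < n \<and> j + 3 \<le> N}" by auto
      then have eq: "coord_space N \<inter> (\<Inter>j\<in>{j. j < Suc n \<and> j + 3 \<le> N}. S j) =
          (coord_space N \<inter> (\<Inter>j\<in>{j. j < n \<and> j + 3 \<le> N}. S j)) \<inter> S n"
        by auto
      have lt: "n < N" "n + 1 < N" "n + 2 < N" using True by auto
      obtain F where F: "polyhedral_decomposition N (S n) F"
        using decomposition_min_attained_twice[OF lt] unfolding S_def by blast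
      obtain G where
        "polyhedral_decomposition N (coord_space N \<inter> (\<Inter>j\<in>{j. j < n \<and> j + 3 \<le> N}. S j)) G"
        using Suc by blast
      then show ?thesis unfolding eq using decomposition_Int[OF _ F] by blast
    next
      case False
      then have "{j. j < Suc n \<and> j + 3 \<le> N} = {j. j < n \<and> j + 3 \<le> N}"
        by (auto simp: less_Suc_eq)
      then show ?thesis using Suc by simp
    qed
  qed
  have "coord_space N \<inter> (\<Inter>j\<in>{j. j < N \<and> j + 3 \<le> N}. S j) = tropical_solutions A B C N"
    unfolding tropical_solutions_def S_def by auto
  then show ?thesis using dec[of N] by simp
qed

end

theory Submission
  imports Defs
begin

text \<open>
  Consecutive terms of a solution \<open>u\<close> enter through the gaps
  \<open>p\<^sub>j = (u\<^bsub>j+1\<^esub> + B(j)) - (u\<^sub>j + A(j))\<close>.  In these coordinates the condition at \<open>j\<close> involves only the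
  drift \<open>D(x) = B(x-1) + B(x) - A(x) - C(x-1)\<close>: with \<open>d = D(j+1)\<close> it says that
  \<open>p\<^bsub>j+1\<^esub> = d\<close> if \<open>p\<^sub>j < 0\<close>, that \<open>p\<^bsub>j+1\<^esub> = d - p\<^sub>j\<close> if \<open>p\<^sub>j > 0\<close>, and only that \<open>p\<^bsub>j+1\<^esub> \<ge> d\<close> if
  \<open>p\<^sub>j = 0\<close> (\<open>tropical_solutions_iff\<close>).  So this is a deterministic dynamical system, except that a
  zero gap lets the next gap branch, and the entropy is the frequency with which an orbit can gain
  a new parameter.

  A parameter gained at a zero gap \<open>p\<^sub>j\<close> is useless if the orbit stays positive from there until it
  reaches zero again: on such a stretch \<open>p\<^bsub>i+1\<^esub> + p\<^sub>i\<close> is prescribed, so arriving at zero fixes the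
  parameter.  It must be forgotten by passing through a negative gap.  The solutions with a given
  sign pattern of gaps span an affine space whose dimension is at most \<open>2\<close> plus the number of these
  branch points (\<open>dim_stratum_directions_le\<close>), and there are only finitely many sign patterns
  (\<open>prevariety_dim_le_branch_points\<close>).  Between two branch points there is a negative gap preceded
  by positive ones (\<open>branch_points_separated\<close>).

  If \<open>D = 0\<close>, the shortest way from one branch point to the next is \<open>0, s, -s, 0\<close>, which takes three
  steps.  If \<open>D\<close> is a positive constant \<open>d\<close>, it is \<open>0, d + s, -s, d, 0\<close>, which takes four.  Both
  cycles repeat with an independent \<open>s \<ge> 0\<close> each time, and the corresponding solutions form an
  orthant inside the prevariety (\<open>prevariety_dim_ge\<close>), so that \<open>1/3\<close> and \<open>1/4\<close> are attained.  If \<open>D\<close>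
  is eventually negative, a negative gap is followed by negative gaps only; if \<open>D\<close> is eventually
  positive and strictly increasing, a negative gap is followed by positive gaps only.  Either way
  the number of branch points stays bounded and the entropy is \<open>0\<close> (\<open>prevariety_dim_bounded\<close>).  A
  polynomial belongs to one of these four kinds, and the two identities of the theorem say that
  \<open>D = 0\<close> and that \<open>D\<close> has period \<open>1\<close>, hence is constant.
\<close>

section \<open>Bounding the dimension of a prevariety\<close>

text \<open>Keeping only the coordinates in \<open>K\<close> is an injective linear map on \<open>V\<close>, with values in the span of
  \<open>card K\<close> unit vectors.\<close>

lemma dim_le_card_separating_coordinates:
  fixes V :: "(nat \<Rightarrow>\<^sub>0 real) set"
  assumes V: "subspace V" and K: "finite K"
    and sep: "\<And>x. x \<in> V \<Longrightarrow> \<forall>k\<in>K. Poly_Mapping.lookup x k = 0 \<Longrightarrow> x = 0"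
  shows "dim V \<le> card K"
proof -
  define f :: "(nat \<Rightarrow>\<^sub>0 real) \<Rightarrow> (nat \<Rightarrow>\<^sub>0 real)" where
    "f x = (\<Sum>k\<in>K. Poly_Mapping.lookup x k *\<^sub>R Poly_Mapping.single k 1)" for x
  let ?E = "(\<lambda>k. Poly_Mapping.single k (1::real)) ` K"
  have lin: "linear f"
    by (rule linearI)
      (simp_all add: f_def lookup_add lookup_scaleR scaleR_add_left sum.distrib scaleR_sum_right)
  have lookup_f: "Poly_Mapping.lookup (f x) k = Poly_Mapping.lookup x k" if "k \<in> K" for x k
  proof -
    have "Poly_Mapping.lookup (f x) k = (\<Sum>i\<in>K. if i = k then Poly_Mapping.lookup x k else 0)"
      unfolding f_def lookup_sum lookup_scaleR
      by (rule sum.cong) (auto simp: lookup_single when_def)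
    then show ?thesis using that K by simp
  qed
  obtain B where B: "B \<subseteq> V" "independent B" "card B = dim V"
    by (metis basis_exists)
  have "inj_on f V"
  proof (rule inj_onI)
    fix x y assume "x \<in> V" "y \<in> V" and eq: "f x = f y"
    then have "x - y \<in> V" using V by (blast intro: subspace_diff)
    moreover have "\<forall>k\<in>K. Poly_Mapping.lookup (x - y) k = 0"
      using eq lookup_f by (metis lookup_minus right_minus_eq)
    ultimately show "x = y" using sep by (metis right_minus_eq)
  qed
  moreover have "span B \<subseteq> V" using B V by (simp add: span_minimal)
  ultimately have inj: "inj_on f (span B)" by (rule inj_on_subset)
  then have "independent (f ` B)"
    using linear_independent_injective_image[OF lin B(2)] by blast
  moreover have "f ` B \<subseteq> span ?E"
    unfolding f_def by (intro image_subsetI span_sum span_scale span_base imageI)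
  ultimately have "card (f ` B) \<le> card ?E"
    using K independent_span_bound[of ?E "f ` B"] by simp
  also have "card (f ` B) = card B"
    using inj by (intro card_image) (meson inj_on_subset span_superset)
  also have "card ?E \<le> card K" using K by (rule card_image_le)
  finally show ?thesis using B(3) by simp
qed

lemma directions_translated_subspace:
  assumes "subspace V"
  shows "directions ((+) u ` V) = V"
proof -
  have "affine ((+) u ` V)"
    using assms affine_translation subspace_imp_affine by blast
  then have hull: "affine hull ((+) u ` V) = (+) u ` V" by simp
  have "x \<in> {a - b | a b. a \<in> (+) u ` V \<and> b \<in> (+) u ` V}" if "x \<in> V" for x
  proof -
    have "x = (u + x) - (u + 0)" by simp
    then show ?thesis using that subspace_0[OF assms] by blast
  qed
  then show ?thesis
    unfolding directions_def hull using subspace_diff[OF assms] by auto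
qed

text \<open>
  The upper bound needs no explicit decomposition into polyhedra.  If the points of \<open>W\<close> are sorted
  by a signature with finitely many values, and points with the same signature differ by a vector
  of \<open>V\<close>, then \<open>W\<close> lies in finitely many translates of these subspaces.  Each polyhedron, being
  convex, lies in a single one of them.
\<close>

lemma prevariety_dim_le:
  assumes dec: "polyhedral_decomposition N W F"
    and fin: "finite (sig ` W)"
    and V: "\<And>s. subspace (V s)" "\<And>s. V s \<subseteq> coord_space N"
    and diff: "\<And>u v. u \<in> W \<Longrightarrow> v \<in> W \<Longrightarrow> sig u = sig v \<Longrightarrow> v - u \<in> V (sig u)"
    and dim: "\<And>u. u \<in> W \<Longrightarrow> dim (V (sig u)) \<le> m"
  shows "prevariety_dim N W \<le> m"
proof -
  have F: "finite F" "F \<noteq> {}" "\<And>P. P \<in> F \<Longrightarrow> is_polyhedron N P" "W = \<Union>F"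
    using dec unfolding polyhedral_decomposition_def by auto
  have WN: "W \<subseteq> coord_space N" using F is_polyhedron_subset by blast
  \<comment> \<open>any member of the class of \<open>s\<close> may serve as the base point of the translate\<close>
  define T where "T s = (+) (inv_into W sig s) ` V s" for s
  have "polyhedron_dim P \<le> m" if P: "P \<in> F" for P
  proof (cases "P = {}")
    case True
    have "dim ({} :: (nat \<Rightarrow>\<^sub>0 real) set) \<le> card ({} :: (nat \<Rightarrow>\<^sub>0 real) set)"
      by (rule dim_le_card) auto
    then show ?thesis
      using True by (simp add: polyhedron_dim_def directions_def)
  next
    case False
    have "W \<subseteq> \<Union>(T ` sig ` W)"
    proof
      fix v assume v: "v \<in> W"
      let ?u = "inv_into W sig (sig v)"
      have "?u \<in> W" "sig ?u = sig v" using v by (auto intro: inv_into_into f_inv_into_f)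
      then have "v - ?u \<in> V (sig v)" using diff v by metis
      then have "?u + (v - ?u) \<in> T (sig v)" unfolding T_def by (rule imageI)
      then have "v \<in> T (sig v)" by simp
      then show "v \<in> \<Union>(T ` sig ` W)" using v by blast
    qed
    then have "P \<subseteq> \<Union>(T ` sig ` W)" using P F(4) by blast
    moreover have "\<forall>A\<in>T ` sig ` W. affine A"
      unfolding T_def using V(1) affine_translation subspace_imp_affine by blast
    ultimately obtain s where s: "s \<in> sig ` W" "P \<subseteq> T s"
      using convex_subset_finite_Union_affine[of "T ` sig ` W" P] fin False
        is_polyhedron_convex[OF F(3)[OF P]] by blast
    have "inv_into W sig s \<in> coord_space N" using inv_into_into[OF s(1)] WN by auto
    then have "T s \<subseteq> coord_space N"
      unfolding T_def using V(2)[of s]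
      by (intro image_subsetI subspace_add[OF subspace_coord_space]) auto
    moreover have "P \<subseteq> affine hull T s" by (rule order_trans[OF s(2) hull_subset])
    ultimately have "polyhedron_dim P \<le> polyhedron_dim (T s)" by (intro polyhedron_dim_mono)
    also have "\<dots> = dim (V s)"
      unfolding polyhedron_dim_def T_def by (simp add: directions_translated_subspace V(1))
    also have "\<dots> \<le> m" using s(1) dim by blast
    finally show ?thesis .
  qed
  then show ?thesis using prevariety_dim_eq[OF dec] F(1,2) by simp
qed

text \<open>The orthant with apex \<open>b\<close> in the coordinate directions \<open>I\<close>.\<close>

definition orthant :: "nat \<Rightarrow> (nat \<Rightarrow>\<^sub>0 real) \<Rightarrow> nat set \<Rightarrow> (nat \<Rightarrow>\<^sub>0 real) set" where
  "orthant N b I = {u \<in> coord_space N. \<forall>i. Poly_Mapping.lookup b i \<le> Poly_Mapping.lookup u i \<and>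
     (i \<notin> I \<longrightarrow> Poly_Mapping.lookup u i = Poly_Mapping.lookup b i)}"

lemma convex_orthant: "convex (orthant N b I)"
proof (rule convexI)
  fix x y and s t :: real
  assume xy: "x \<in> orthant N b I" "y \<in> orthant N b I" and st: "0 \<le> s" "0 \<le> t" "s + t = 1"
  have split: "s * c + t * c = c" for c :: real
    using st(3) by (metis distrib_right mult_1)
  have "s *\<^sub>R x + t *\<^sub>R y \<in> coord_space N"
    using xy subspace_coord_space unfolding orthant_def
    by (auto intro: subspace_add subspace_scale)
  moreover have "Poly_Mapping.lookup b i \<le> Poly_Mapping.lookup (s *\<^sub>R x + t *\<^sub>R y) i" for i
  proof -
    have "s * Poly_Mapping.lookup b i + t * Poly_Mapping.lookup b i
        \<le> s * Poly_Mapping.lookup x i + t * Poly_Mapping.lookup y i"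
      using xy st unfolding orthant_def by (intro add_mono mult_left_mono) auto
    then show ?thesis by (simp add: split lookup_add lookup_scaleR)
  qed
  moreover have "Poly_Mapping.lookup (s *\<^sub>R x + t *\<^sub>R y) i = Poly_Mapping.lookup b i"
    if "i \<notin> I" for i
    using xy that unfolding orthant_def by (simp add: split lookup_add lookup_scaleR)
  ultimately show "s *\<^sub>R x + t *\<^sub>R y \<in> orthant N b I" unfolding orthant_def by blast
qed

lemma independent_unit_vectors: "independent ((\<lambda>i. Poly_Mapping.single i (1::real)) ` I)"
proof
  let ?E = "(\<lambda>i. Poly_Mapping.single i (1::real)) ` I"
  assume "dependent ?E"
  then obtain i where i: "i \<in> I"
    "Poly_Mapping.single i (1::real) \<in> span (?E - {Poly_Mapping.single i 1})"
    unfolding dependent_def by blast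
  have "subspace {u. Poly_Mapping.lookup u i = (0::real)}"
    by (simp add: subspace_def lookup_add lookup_scaleR)
  moreover have "?E - {Poly_Mapping.single i 1} \<subseteq> {u. Poly_Mapping.lookup u i = 0}"
    by (auto simp: lookup_single when_def)
  ultimately have "span (?E - {Poly_Mapping.single i 1}) \<subseteq> {u. Poly_Mapping.lookup u i = 0}"
    by (rule span_minimal[rotated])
  with i(2) show False by auto
qed

text \<open>An orthant inside \<open>W\<close> is convex, so the affine hull of a single polyhedron of any decomposition
  contains it, and with it the \<open>card I\<close> unit vectors as directions.\<close>

lemma card_le_prevariety_dim:
  assumes dec: "polyhedral_decomposition N W F"
    and b: "b \<in> coord_space N" and I: "I \<subseteq> {..<N}" and sub: "orthant N b I \<subseteq> W"
  shows "card I \<le> prevariety_dim N W"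
proof -
  let ?O = "orthant N b I" and ?e = "\<lambda>i. Poly_Mapping.single i (1::real)"
  have F: "finite F" "F \<noteq> {}" "\<And>P. P \<in> F \<Longrightarrow> is_polyhedron N P" "W = \<Union>F"
    using dec unfolding polyhedral_decomposition_def by auto
  have bO: "b \<in> ?O" using b by (simp add: orthant_def)
  have "?O \<subseteq> \<Union>((\<lambda>Q. affine hull Q) ` F)"
  proof
    fix x assume "x \<in> ?O"
    then obtain Q where "Q \<in> F" "x \<in> Q" using sub F(4) by blast
    then show "x \<in> \<Union>((\<lambda>Q. affine hull Q) ` F)" by (auto intro: hull_inc)
  qed
  then obtain Q where Q: "Q \<in> F" "?O \<subseteq> affine hull Q"
    using convex_subset_finite_Union_affine[of "(\<lambda>Q. affine hull Q) ` F" ?O]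
      F(1) convex_orthant bO by auto
  have "?O \<subseteq> coord_space N" by (auto simp: orthant_def)
  then have "affine hull ?O \<subseteq> coord_space N"
    by (intro hull_minimal subspace_imp_affine subspace_coord_space)
  then have dN: "directions ?O \<subseteq> coord_space N"
    unfolding directions_def using subspace_diff[OF subspace_coord_space] by blast
  have dir: "?e ` I \<subseteq> directions ?O"
  proof
    fix x assume "x \<in> ?e ` I"
    then obtain i where i: "i \<in> I" "x = ?e i" by blast
    have "b + ?e i \<in> affine hull ?O" "b \<in> affine hull ?O"
      using i(1) b I bO
      by (auto intro!: hull_inc simp: orthant_def coord_space_iff lookup_add lookup_single when_def)
    then have "(b + ?e i) - b \<in> directions ?O"
      unfolding directions_def by blast
    then show "x \<in> directions ?O" using i by simp
  qed
  obtain D where D: "D \<subseteq> directions ?O" "independent D" "directions ?O \<subseteq> span D"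
    "card D = dim (directions ?O)"
    by (metis basis_exists)
  have "finite D"
    using independent_span_bound[of "?e ` {..<N}" D] D dN coord_space_subset_span[of N] by auto
  then have "card (?e ` I) \<le> card D"
    using independent_span_bound[of D "?e ` I"] D(3) dir independent_unit_vectors by blast
  moreover have "inj_on ?e I"
    by (rule inj_onI) (metis lookup_single_eq lookup_single_not_eq zero_neq_one)
  ultimately have "card I \<le> polyhedron_dim ?O"
    using D(4) by (simp add: card_image polyhedron_dim_def)
  also have "\<dots> \<le> polyhedron_dim Q"
    using polyhedron_dim_mono[OF Q(2)] is_polyhedron_subset[OF F(3)[OF Q(1)]] .
  also have "\<dots> \<le> Max (polyhedron_dim ` F)" using F(1) Q(1) by simp
  also have "\<dots> = prevariety_dim N W" using prevariety_dim_eq[OF dec] by simp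
  finally show ?thesis .
qed

section \<open>The recurrence as a dynamical system\<close>

definition gap :: "real poly \<Rightarrow> real poly \<Rightarrow> (nat \<Rightarrow>\<^sub>0 real) \<Rightarrow> nat \<Rightarrow> real" where
  "gap A B u j = (Poly_Mapping.lookup u (j + 1) + poly B (real j))
     - (Poly_Mapping.lookup u j + poly A (real j))"

text \<open>In the condition at \<open>j\<close>, the third term minus the second one is the gap at \<open>j + 1\<close> minus the value of
  this polynomial at \<open>j + 1\<close>.\<close>

definition drift :: "real poly \<Rightarrow> real poly \<Rightarrow> real poly \<Rightarrow> real poly" where
  "drift A B C = pcompose B [:-1, 1:] + B - A - pcompose C [:-1, 1:]"

lemma poly_drift:
  "poly (drift A B C) x = poly B (x - 1) + poly B x - poly A x - poly C (x - 1)"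
  by (simp add: drift_def poly_pcompose algebra_simps)

text \<open>The relation between a gap \<open>p\<close> and the next gap \<open>p'\<close> when the drift there is \<open>d\<close>.  It is a function
  of \<open>p\<close> except at \<open>p = 0\<close>.\<close>

definition gap_step :: "real \<Rightarrow> real \<Rightarrow> real \<Rightarrow> bool" where
  "gap_step d p p' \<longleftrightarrow> (p < 0 \<longrightarrow> p' = d) \<and> (p = 0 \<longrightarrow> d \<le> p') \<and> (0 < p \<longrightarrow> p' = d - p)"

lemma min_attained_twice_iff:
  "min_attained_twice x y z \<longleftrightarrow>
     (y < x \<longrightarrow> z = y) \<and> (y = x \<longrightarrow> y \<le> z) \<and> (x < y \<longrightarrow> z = x)"
  by (auto simp: min_attained_twice_def Let_def min_def)

text \<open>The differences of the three terms at \<open>j\<close> are the gap \<open>p\<close> (second minus first) and \<open>p' - d\<close> (third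
  minus second), whence the absolute values of \<open>u\<close> disappear from the conditions.\<close>

lemma tropical_solutions_iff:
  "u \<in> tropical_solutions A B C N \<longleftrightarrow> u \<in> coord_space N \<and>
    (\<forall>j. j + 3 \<le> N \<longrightarrow>
      gap_step (poly (drift A B C) (real (j + 1))) (gap A B u j) (gap A B u (j + 1)))"
proof -
  have "min_attained_twice
          (Poly_Mapping.lookup u j + poly A (real j))
          (Poly_Mapping.lookup u (j + 1) + poly B (real j))
          (Poly_Mapping.lookup u (j + 2) + poly C (real j)) \<longleftrightarrow>
        gap_step (poly (drift A B C) (real (j + 1))) (gap A B u j) (gap A B u (j + 1))" for j
    unfolding min_attained_twice_iff gap_step_def gap_def poly_drift by auto
  then show ?thesis by (simp add: tropical_solutions_def)
qed

section \<open>Counting branch points bounds the dimension\<close>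

text \<open>A sign pattern records which two of the three terms attain the minimum.  The value \<open>0\<close> beyond
  the last condition makes the set of sign patterns finite for each \<open>N\<close>.\<close>

definition signature :: "real poly \<Rightarrow> real poly \<Rightarrow> nat \<Rightarrow> (nat \<Rightarrow>\<^sub>0 real) \<Rightarrow> nat \<Rightarrow> real" where
  "signature A B N u j = (if j + 3 \<le> N then sgn (gap A B u j) else 0)"

text \<open>The homogeneous form of the equalities between terms that a sign pattern \<open>\<sigma>\<close> prescribes: a negative
  gap equates the second and third term, a zero gap the first and second, a positive gap the first
  and third.\<close>

definition stratum_directions :: "nat \<Rightarrow> (nat \<Rightarrow> real) \<Rightarrow> (nat \<Rightarrow>\<^sub>0 real) set" where
  "stratum_directions N \<sigma> = {x \<in> coord_space N. \<forall>j. j + 3 \<le> N \<longrightarrow>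
     (\<sigma> j < 0 \<longrightarrow> Poly_Mapping.lookup x (j + 2) = Poly_Mapping.lookup x (j + 1)) \<and>
     (\<sigma> j = 0 \<longrightarrow> Poly_Mapping.lookup x (j + 1) = Poly_Mapping.lookup x j) \<and>
     (0 < \<sigma> j \<longrightarrow> Poly_Mapping.lookup x (j + 2) = Poly_Mapping.lookup x j)}"

text \<open>The zero gaps that are not joined to a later zero gap by positive gaps only.  A zero gap with
  nothing but positive gaps up to the last condition counts as a branch point as well.\<close>

definition branch_points :: "nat \<Rightarrow> (nat \<Rightarrow> real) \<Rightarrow> nat set" where
  "branch_points N \<sigma> = {j. j + 3 \<le> N \<and> \<sigma> j = 0 \<and>
     \<not> (\<exists>k. j < k \<and> k + 3 \<le> N \<and> \<sigma> k = 0 \<and> (\<forall>i. j < i \<and> i < k \<longrightarrow> 0 < \<sigma> i))}"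

lemma branch_pointsD:
  assumes "j \<in> branch_points N \<sigma>"
  shows "j + 3 \<le> N" "\<sigma> j = 0"
  using assms unfolding branch_points_def by blast+

lemma subspace_stratum_directions: "subspace (stratum_directions N \<sigma>)"
  using subspace_coord_space[of N] unfolding subspace_def stratum_directions_def
  by (auto simp: lookup_add lookup_scaleR)

lemma difference_in_stratum_directions:
  assumes u: "u \<in> tropical_solutions A B C N" and v: "v \<in> tropical_solutions A B C N"
    and sig: "signature A B N u = signature A B N v"
  shows "v - u \<in> stratum_directions N (signature A B N u)"
proof -
  let ?x = "v - u"
  have "?x \<in> coord_space N"
    using u v subspace_diff[OF subspace_coord_space] by (simp add: tropical_solutions_def)
  moreover have "(signature A B N u j < 0 \<longrightarrow>
        Poly_Mapping.lookup ?x (j + 2) = Poly_Mapping.lookup ?x (j + 1)) \<and>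
     (signature A B N u j = 0 \<longrightarrow> Poly_Mapping.lookup ?x (j + 1) = Poly_Mapping.lookup ?x j) \<and>
     (0 < signature A B N u j \<longrightarrow> Poly_Mapping.lookup ?x (j + 2) = Poly_Mapping.lookup ?x j)"
    if j: "j + 3 \<le> N" for j
  proof -
    have "sgn (gap A B u j) = sgn (gap A B v j)"
      using fun_cong[OF sig, of j] j by (simp add: signature_def)
    moreover have "gap A B v i - gap A B u i
        = Poly_Mapping.lookup ?x (i + 1) - Poly_Mapping.lookup ?x i" for i
      by (simp add: gap_def lookup_minus)
    note this[of j] this[of "j + 1"]
    moreover have "gap_step (poly (drift A B C) (real (j + 1))) (gap A B u j) (gap A B u (j + 1))"
      "gap_step (poly (drift A B C) (real (j + 1))) (gap A B v j) (gap A B v (j + 1))"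
      using u v j unfolding tropical_solutions_iff by blast+
    ultimately show ?thesis
      unfolding gap_step_def using j
      by (simp add: signature_def sgn_if split: if_splits)
  qed
  ultimately show ?thesis by (simp add: stratum_directions_def)
qed

lemma finite_branch_points: "finite (branch_points N \<sigma>)"
  by (rule finite_subset[of _ "{..<N}"]) (auto dest: branch_pointsD(1))

text \<open>
  A direction vector is determined from left to right by its entries \<open>0\<close>, \<open>1\<close> and \<open>j + 2\<close> for branch
  points \<open>j\<close>.  The only other place where the equation at \<open>j\<close> does not give the entry \<open>j + 2\<close> is a zero
  gap joined by positive gaps to a zero gap \<open>k\<close>; there it is found backwards from \<open>k\<close>.
\<close>

lemma dim_stratum_directions_le: "dim (stratum_directions N \<sigma>) \<le> card (branch_points N \<sigma>) + 2"
proof -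
  let ?S = "branch_points N \<sigma>"
  let ?K = "{0, 1} \<union> (\<lambda>j. j + 2) ` ?S"
  have "dim (stratum_directions N \<sigma>) \<le> card ?K"
  proof (rule dim_le_card_separating_coordinates[OF subspace_stratum_directions])
    show "finite ?K" using finite_branch_points by simp
    fix x assume x: "x \<in> stratum_directions N \<sigma>" and K: "\<forall>k\<in>?K. Poly_Mapping.lookup x k = 0"
    have "Poly_Mapping.lookup x n = 0" for n
    proof (induction n rule: less_induct)
      case (less n)
      show ?case
      proof (cases "n \<le> 1 \<or> N \<le> n")
        case True
        then show ?thesis
        proof
          assume "n \<le> 1"
          then have "n = 0 \<or> n = 1" by auto
          then show ?thesis using K by auto
        next
          assume "N \<le> n"
          then show ?thesis using x by (simp add: stratum_directions_def coord_space_iff)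
        qed
      next
        case False
        define j where "j = n - 2"
        have n: "n = j + 2" and j: "j + 3 \<le> N" using False by (auto simp: j_def)
        have prev: "Poly_Mapping.lookup x j = 0" "Poly_Mapping.lookup x (j + 1) = 0"
          using less.IH n by auto
        note eqs = x[unfolded stratum_directions_def, simplified, THEN conjunct2, rule_format]
        consider "\<sigma> j < 0" | "0 < \<sigma> j" | "j \<in> ?S" | "\<sigma> j = 0" "j \<notin> ?S" by fastforce
        then show ?thesis
        proof cases
          case 4
          then obtain k where k: "j < k" "k + 3 \<le> N" "\<sigma> k = 0" "\<And>i. j < i \<Longrightarrow> i < k \<Longrightarrow> 0 < \<sigma> i"
            using j unfolding branch_points_def by blast
          \<comment> \<open>positive gaps make \<open>x\<^bsub>i+1\<^esub> - x\<^sub>i\<close> alternate in sign, so its vanishing at \<open>k\<close> propagates down\<close>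
          have "Suc j \<le> k" using k(1) by simp
          then have "Poly_Mapping.lookup x (Suc j + 1) = Poly_Mapping.lookup x (Suc j)"
          proof (induction rule: inc_induct)
            case base
            then show ?case using eqs[of k] k by simp
          next
            case (step i)
            then show ?case using eqs[of i] k by simp
          qed
          then show ?thesis using prev n by simp
        qed (use K prev n j eqs[of j] in auto)
      qed
    qed
    then show "x = 0" by (intro poly_mapping_eqI) simp
  qed
  also have "\<dots> \<le> card {0::nat, 1} + card ((\<lambda>j. j + 2) ` ?S)" by (rule card_Un_le)
  also have "\<dots> \<le> 2 + card ?S"
    using card_image_le[OF finite_branch_points] by (intro add_mono) auto
  finally show ?thesis by simp
qed

lemma prevariety_dim_le_branch_points:
  assumes "\<And>u. u \<in> tropical_solutions A B C N \<Longrightarrow>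
    card (branch_points N (signature A B N u)) \<le> m"
  shows "prevariety_dim N (tropical_solutions A B C N) \<le> m + 2"
proof -
  let ?W = "tropical_solutions A B C N"
  obtain F where "polyhedral_decomposition N ?W F"
    using decomposition_tropical_solutions by blast
  moreover have "finite (signature A B N ` ?W)"
  proof (rule finite_subset)
    show "signature A B N ` ?W \<subseteq>
        {f. \<forall>j. (j \<in> {..<N} \<longrightarrow> f j \<in> {-1, 0, 1}) \<and> (j \<notin> {..<N} \<longrightarrow> f j = 0)}"
      by (auto simp: signature_def sgn_if)
  qed (intro finite_set_of_finite_funs; simp)
  moreover have "dim (stratum_directions N (signature A B N u)) \<le> m + 2" if "u \<in> ?W" for u
    using dim_stratum_directions_le[of N "signature A B N u"] assms[OF that] by linarith
  ultimately show ?thesis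
    using subspace_stratum_directions difference_in_stratum_directions
    by (intro prevariety_dim_le[where sig = "signature A B N" and V = "stratum_directions N"])
      (auto simp: stratum_directions_def)
qed

text \<open>The first non-positive entry after \<open>j\<close> cannot be zero, for otherwise it would disqualify \<open>j\<close> as a branch
  point; hence it is negative and comes before \<open>j'\<close>.\<close>

lemma branch_points_separated:
  assumes "j \<in> branch_points N \<sigma>" "j' \<in> branch_points N \<sigma>" "j < j'"
  obtains k where "j < k" "k < j'" "\<sigma> k < 0" "\<And>i. j < i \<Longrightarrow> i < k \<Longrightarrow> 0 < \<sigma> i"
proof -
  note j' = branch_pointsD[OF assms(2)]
  define k where "k = (LEAST k. j < k \<and> \<not> 0 < \<sigma> k)"
  have cand: "j < j' \<and> \<not> 0 < \<sigma> j'" using assms(3) j' by simp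
  have k: "j < k" "\<not> 0 < \<sigma> k" "k \<le> j'"
    using LeastI[of "\<lambda>k. j < k \<and> \<not> 0 < \<sigma> k", OF cand]
      Least_le[of "\<lambda>k. j < k \<and> \<not> 0 < \<sigma> k", OF cand]
    unfolding k_def by blast+
  have pos: "0 < \<sigma> i" if "j < i" "i < k" for i
    using that not_less_Least[of i "\<lambda>k. j < k \<and> \<not> 0 < \<sigma> k"] unfolding k_def by blast
  have "\<sigma> k \<noteq> 0"
    using assms(1) k j' pos unfolding branch_points_def by fastforce
  then have "\<sigma> k < 0" "k \<noteq> j'" using k(2) j'(2) by auto
  with k pos show thesis by (intro that[of k]) auto
qed

lemma card_spaced_le:
  assumes "finite S" "S \<subseteq> {..<N}" "0 < L" "\<And>i j. i \<in> S \<Longrightarrow> j \<in> S \<Longrightarrow> i < j \<Longrightarrow> i + L \<le> j"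
  shows "card S \<le> N div L + 1"
proof -
  have "inj_on (\<lambda>j. j div L) S"
  proof (rule linorder_inj_onI')
    fix i j assume "i \<in> S" "j \<in> S" "i < j"
    then have "(i + L) div L \<le> j div L" using assms(4) by (intro div_le_mono)
    then show "i div L \<noteq> j div L" using assms(3) by simp
  qed
  moreover have "(\<lambda>j. j div L) ` S \<subseteq> {..N div L}"
    using assms(2) by (auto intro!: div_le_mono)
  ultimately show ?thesis
    using card_inj_on_le[of "\<lambda>j. j div L" S "{..N div L}"] by simp
qed

section \<open>Spacing of the branch points\<close>

lemma branch_points_gap_pattern:
  assumes "j \<in> branch_points N (signature A B N u)" "j' \<in> branch_points N (signature A B N u)"
    "j < j'"
  obtains k where "j < k" "k < j'" "gap A B u j = 0" "gap A B u k < 0" "gap A B u j' = 0"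
    "j' + 3 \<le> N" "\<And>i. j < i \<Longrightarrow> i < k \<Longrightarrow> 0 < gap A B u i"
proof -
  note N = branch_pointsD(1)[OF assms(1)] branch_pointsD(1)[OF assms(2)]
  have z: "gap A B u j = 0" "gap A B u j' = 0"
    using branch_pointsD(2)[OF assms(1)] branch_pointsD(2)[OF assms(2)] N
    by (simp_all add: signature_def sgn_0_0)
  obtain k where k: "j < k" "k < j'" "signature A B N u k < 0"
    "\<And>i. j < i \<Longrightarrow> i < k \<Longrightarrow> 0 < signature A B N u i"
    using branch_points_separated[OF assms] by blast
  have "0 < gap A B u i" if "j < i" "i < k" for i
    using k(4)[OF that] by (auto simp: signature_def split: if_splits)
  moreover have "gap A B u k < 0" using k(3) by (auto simp: signature_def split: if_splits)
  ultimately show thesis using z k N by (intro that[of k]) auto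
qed

lemma prevariety_dim_le_spaced:
  assumes "0 < L"
    and "\<And>u i j. \<lbrakk>u \<in> tropical_solutions A B C N; i \<in> branch_points N (signature A B N u);
        j \<in> branch_points N (signature A B N u); i < j\<rbrakk> \<Longrightarrow> i + L \<le> j"
  shows "prevariety_dim N (tropical_solutions A B C N) \<le> N div L + 3"
proof -
  have "card (branch_points N (signature A B N u)) \<le> N div L + 1"
    if "u \<in> tropical_solutions A B C N" for u
    using assms that finite_branch_points
    by (intro card_spaced_le) (auto dest: branch_pointsD(1))
  then show ?thesis using prevariety_dim_le_branch_points[of A B C N "N div L + 1"] by simp
qed

text \<open>With zero drift a zero gap is followed by a nonnegative one, so the negative gap comes at \<open>j + 2\<close> at the
  earliest.\<close>

lemma prevariety_dim_le_zero_drift: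
  assumes "\<And>j. poly (drift A B C) (real j) = 0"
  shows "prevariety_dim N (tropical_solutions A B C N) \<le> N div 3 + 3"
proof (rule prevariety_dim_le_spaced)
  fix u j j'
  assume u: "u \<in> tropical_solutions A B C N"
    and j: "j \<in> branch_points N (signature A B N u)" "j' \<in> branch_points N (signature A B N u)"
      "j < j'"
  obtain k where k: "j < k" "k < j'" "gap A B u j = 0" "gap A B u k < 0" "j' + 3 \<le> N"
    using branch_points_gap_pattern[OF j] by metis
  then have "j + 3 \<le> N" by simp
  then have "gap_step 0 (gap A B u j) (gap A B u (j + 1))"
    using u unfolding tropical_solutions_iff assms by blast
  then have "k \<noteq> j + 1" using k by (auto simp: gap_step_def)
  then show "j + 3 \<le> j'" using k by simp
qed simp

text \<open>With constant drift \<open>d > 0\<close> there is one more step, because the negative gap is followed by \<open>d\<close>, which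
  is not zero.\<close>

lemma prevariety_dim_le_positive_drift:
  assumes "\<And>j. poly (drift A B C) (real j) = d" "0 < d"
  shows "prevariety_dim N (tropical_solutions A B C N) \<le> N div 4 + 3"
proof (rule prevariety_dim_le_spaced)
  fix u j j'
  assume u: "u \<in> tropical_solutions A B C N"
    and j: "j \<in> branch_points N (signature A B N u)" "j' \<in> branch_points N (signature A B N u)"
      "j < j'"
  obtain k where k: "j < k" "k < j'" "gap A B u j = 0" "gap A B u k < 0" "gap A B u j' = 0"
      "j' + 3 \<le> N"
    using branch_points_gap_pattern[OF j] by metis
  have step: "gap_step d (gap A B u i) (gap A B u (i + 1))" if "i < j'" for i
  proof -
    have "i + 3 \<le> N" using that k(6) by simp
    then show ?thesis using u unfolding tropical_solutions_iff assms(1) by blast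
  qed
  have "k \<noteq> j + 1" using step[of j] k assms(2) j(3) by (auto simp: gap_step_def)
  moreover have "j' \<noteq> k + 1" using step[of k] k assms(2) by (auto simp: gap_step_def)
  ultimately show "j + 4 \<le> j'" using k by simp
qed simp

text \<open>
  After position \<open>J\<close> a negative gap is never followed by a zero gap.  If the drift is negative,
  negative gaps reproduce themselves.  If it is positive and increasing, a negative gap leads into
  the region where the gap \<open>p\<^sub>i\<close> satisfies \<open>0 < p\<^sub>i \<le> D(i)\<close>, and this region is invariant since
  \<open>p\<^bsub>i+1\<^esub> = D(i+1) - p\<^sub>i \<ge> D(i+1) - D(i)\<close>.  So only the last branch point can be \<open>J\<close> or larger.
\<close>

lemma prevariety_dim_bounded:
  assumes "(\<forall>j>J. poly (drift A B C) (real j) < 0) \<or>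
    (\<forall>j>J. 0 < poly (drift A B C) (real j) \<and>
       poly (drift A B C) (real j) < poly (drift A B C) (real (j + 1)))"
  shows "prevariety_dim N (tropical_solutions A B C N) \<le> J + 3"
proof -
  let ?d = "\<lambda>j. poly (drift A B C) (real j)"
  have "card (branch_points N (signature A B N u)) \<le> J + 1"
    if u: "u \<in> tropical_solutions A B C N" for u
  proof -
    let ?S = "branch_points N (signature A B N u)" and ?p = "gap A B u"
    have early: "j < J" if j: "j \<in> ?S" "j' \<in> ?S" "j < j'" for j j'
    proof (rule ccontr)
      assume J: "\<not> j < J"
      obtain k where k: "j < k" "k < j'" "?p k < 0" "?p j' = 0" "j' + 3 \<le> N"
        using branch_points_gap_pattern[OF j] by metis
      have step: "gap_step (?d (i + 1)) (?p i) (?p (i + 1))" if "i < j'" for i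
        using u that k(5) unfolding tropical_solutions_iff by simp
      have kj: "Suc k \<le> j'" using k by simp
      show False using assms
      proof
        assume neg: "\<forall>j>J. ?d j < 0"
        have "k \<le> j'" using k by simp
        then have "?p j' < 0"
        proof (induction rule: dec_induct)
          case base
          show ?case by (rule k(3))
        next
          case (step i)
          then show ?case
            using \<open>i < j' \<Longrightarrow> gap_step (?d (i + 1)) (?p i) (?p (i + 1))\<close>
              spec[OF neg, of "i + 1"] J k(1)
            by (simp add: gap_step_def)
        qed
        then show False using k by simp
      next
        assume pos: "\<forall>j>J. 0 < ?d j \<and> ?d j < ?d (j + 1)"
        from kj have "0 < ?p j' \<and> ?p j' \<le> ?d j'"
        proof (induction rule: dec_induct)
          case base
          show ?case using step[of k] k J spec[OF pos, of "k + 1"] by (simp add: gap_step_def)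
        next
          case (step i)
          then have "?p (i + 1) = ?d (i + 1) - ?p i"
            using \<open>i < j' \<Longrightarrow> gap_step (?d (i + 1)) (?p i) (?p (i + 1))\<close>
            by (simp add: gap_step_def)
          moreover have "?d i < ?d (i + 1)" using pos step.hyps k J by simp
          ultimately show ?case using step.IH by simp
        qed
        then show False using k by simp
      qed
    qed
    have "?S \<subseteq> {..<J} \<union> {Max ?S}"
    proof
      fix j assume "j \<in> ?S"
      then show "j \<in> {..<J} \<union> {Max ?S}"
        using early[of j "Max ?S"] finite_branch_points
        by (metis Max_ge Max_in UnI1 UnI2 empty_iff insertI1 le_neq_implies_less lessThan_iff)
    qed
    then have "card ?S \<le> card ({..<J} \<union> {Max ?S})" by (intro card_mono) auto
    also have "\<dots> \<le> J + 1" using card_Un_le[of "{..<J}" "{Max ?S}"] by simp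
    finally show ?thesis .
  qed
  then show ?thesis using prevariety_dim_le_branch_points[of A B C N "J + 1"] by simp
qed

section \<open>Periodic families of solutions\<close>

lemma exists_gaps:
  "\<exists>b \<in> coord_space N. \<forall>j. j + 1 < N \<longrightarrow> gap A B b j = g j"
proof -
  define v where "v i = (\<Sum>j<i. g j + poly A (real j) - poly B (real j))" for i
  define b where "b = (\<Sum>i<N. Poly_Mapping.single i (v i))"
  have lookup_b: "Poly_Mapping.lookup b k = (if k < N then v k else 0)" for k
    unfolding b_def lookup_sum by (simp add: lookup_single when_def)
  then have "b \<in> coord_space N" by (simp add: coord_space_iff)
  moreover have "gap A B b j = g j" if "j + 1 < N" for j
    using that by (simp add: gap_def lookup_b v_def)
  ultimately show ?thesis by blast
qed

text \<open>
  Let \<open>g\<close> be the gaps of one solution.  Raising the entry \<open>i\<close> of the solution by \<open>s\<close> adds \<open>s\<close> to the gap at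
  \<open>i - 1\<close> and subtracts it at \<open>i\<close>.  In a cycle of length \<open>L\<close> that starts with a zero gap, the free
  parameter appears in the second gap and is cancelled in the third one, so it sits in the
  entries with index \<open>2\<close> modulo \<open>L\<close>.
\<close>

lemma prevariety_dim_ge:
  assumes L: "2 < L"
    and step: "\<And>s j. \<lbrakk>\<And>i. 0 \<le> s i; \<And>i. i mod L \<noteq> 2 \<Longrightarrow> s i = 0\<rbrakk> \<Longrightarrow>
      gap_step (poly (drift A B C) (real (j + 1)))
        (g j + s (j + 1) - s j) (g (j + 1) + s (j + 2) - s (j + 1))"
  shows "N div L \<le> prevariety_dim N (tropical_solutions A B C N)"
proof -
  let ?W = "tropical_solutions A B C N" and ?I = "{i. i < N \<and> i mod L = 2}"
  obtain F where F: "polyhedral_decomposition N ?W F"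
    using decomposition_tropical_solutions by blast
  obtain b where b: "b \<in> coord_space N" "\<And>j. j + 1 < N \<Longrightarrow> gap A B b j = g j"
    using exists_gaps by metis
  have "u \<in> ?W" if u: "u \<in> orthant N b ?I" for u
  proof -
    define s where "s i = Poly_Mapping.lookup u i - Poly_Mapping.lookup b i" for i
    have s: "0 \<le> s i" "i mod L \<noteq> 2 \<Longrightarrow> s i = 0" for i
      using u by (auto simp: s_def orthant_def)
    have gap: "gap A B u j = g j + s (j + 1) - s j" if "j + 1 < N" for j
      using b(2)[OF that] by (simp add: s_def gap_def)
    have "gap_step (poly (drift A B C) (real (j + 1))) (gap A B u j) (gap A B u (j + 1))"
      if "j + 3 \<le> N" for j
      using step[of s j] s gap[of j] gap[of "j + 1"] that by simp
    then show ?thesis using u unfolding tropical_solutions_iff orthant_def by blast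
  qed
  then have "card ?I \<le> prevariety_dim N ?W"
    by (intro card_le_prevariety_dim[OF F b(1)]) auto
  moreover have "card {..<N div L} \<le> card ?I"
  proof (rule card_inj_on_le[of "\<lambda>q. q * L + 2"])
    show "inj_on (\<lambda>q. q * L + 2) {..<N div L}" using L by (intro inj_onI) simp
    show "(\<lambda>q. q * L + 2) ` {..<N div L} \<subseteq> ?I"
    proof clarsimp
      fix q assume "q < N div L"
      then have "Suc q * L \<le> N div L * L" by (intro mult_le_mono1) simp
      also have "\<dots> \<le> N" by simp
      finally have "L + q * L \<le> N" by simp
      moreover have "(q * L + 2) mod L = 2" using L by (subst mod_mult_self3) simp
      ultimately show "Suc (Suc (q * L)) < N \<and> Suc (Suc (q * L)) mod L = 2" using L by simp
    qed
  qed simp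
  ultimately show ?thesis by simp
qed

text \<open>The cycle of gaps is \<open>0, s, -s\<close>.\<close>

lemma prevariety_dim_ge_zero_drift:
  assumes "\<And>j. poly (drift A B C) (real j) = 0"
  shows "N div 3 \<le> prevariety_dim N (tropical_solutions A B C N)"
proof (rule prevariety_dim_ge[where g = "\<lambda>_. 0"])
  fix s :: "nat \<Rightarrow> real" and j :: nat
  assume s: "\<And>i. 0 \<le> s i" "\<And>i. i mod 3 \<noteq> 2 \<Longrightarrow> s i = 0"
  have "j mod 3 = 0 \<or> j mod 3 = 1 \<or> j mod 3 = 2" by presburger
  then show "gap_step (poly (drift A B C) (real (j + 1)))
      (0 + s (j + 1) - s j) (0 + s (j + 2) - s (j + 1))"
  proof (elim disjE)
    assume "j mod 3 = 0"
    then have "(j + 1) mod 3 \<noteq> 2" "j mod 3 \<noteq> 2" by presburger+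
    then show ?thesis using s(1)[of "j + 2"] s(2) assms[of "j + 1"] by (simp add: gap_step_def)
  next
    assume "j mod 3 = 1"
    then have "(j + 2) mod 3 \<noteq> 2" "j mod 3 \<noteq> 2" by presburger+
    then show ?thesis using s(1)[of "j + 1"] s(2) assms[of "j + 1"] by (simp add: gap_step_def)
  next
    assume "j mod 3 = 2"
    then have "(j + 1) mod 3 \<noteq> 2" "(j + 2) mod 3 \<noteq> 2" by presburger+
    then show ?thesis using s(1)[of j] s(2) assms[of "j + 1"] by (simp add: gap_step_def)
  qed
qed simp_all

text \<open>The cycle of gaps is \<open>0, d + s, -s, d\<close>.\<close>

lemma prevariety_dim_ge_positive_drift:
  assumes "\<And>j. poly (drift A B C) (real j) = d" "0 < d"
  shows "N div 4 \<le> prevariety_dim N (tropical_solutions A B C N)"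
proof (rule prevariety_dim_ge[where g = "\<lambda>j. if odd j then d else 0"])
  fix s :: "nat \<Rightarrow> real" and j :: nat
  let ?g = "\<lambda>j :: nat. if odd j then d else 0"
  assume s: "\<And>i. 0 \<le> s i" "\<And>i. i mod 4 \<noteq> 2 \<Longrightarrow> s i = 0"
  have "j mod 4 = 0 \<or> j mod 4 = 1 \<or> j mod 4 = 2 \<or> j mod 4 = 3" by presburger
  then show "gap_step (poly (drift A B C) (real (j + 1)))
      (?g j + s (j + 1) - s j) (?g (j + 1) + s (j + 2) - s (j + 1))"
  proof (elim disjE)
    assume "j mod 4 = 0"
    then have "(j + 1) mod 4 \<noteq> 2" "j mod 4 \<noteq> 2" "even j" by presburger+
    then show ?thesis using s(1)[of "j + 2"] s(2) assms(1)[of "j + 1"] by (simp add: gap_step_def)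
  next
    assume "j mod 4 = 1"
    then have "(j + 2) mod 4 \<noteq> 2" "j mod 4 \<noteq> 2" "odd j" by presburger+
    then show ?thesis
      using s(1)[of "j + 1"] s(2) assms(1)[of "j + 1"] assms(2) by (simp add: gap_step_def)
  next
    assume "j mod 4 = 2"
    then have "(j + 1) mod 4 \<noteq> 2" "(j + 2) mod 4 \<noteq> 2" "even j" by presburger+
    then show ?thesis using s(1)[of j] s(2) assms(1)[of "j + 1"] by (simp add: gap_step_def)
  next
    assume "j mod 4 = 3"
    then have "(j + 1) mod 4 \<noteq> 2" "(j + 2) mod 4 \<noteq> 2" "j mod 4 \<noteq> 2" "odd j" by presburger+
    then show ?thesis using s(2) assms(1)[of "j + 1"] assms(2) by (simp add: gap_step_def)
  qed
qed simp_all

section \<open>The three regimes of the drift\<close>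

lemma limit_of_linear_growth:
  assumes "0 < L" "\<And>N. N div L \<le> f N" "\<And>N. f N \<le> N div L + c"
  shows "(\<lambda>N. real (f N) / real N) \<longlonglongrightarrow> 1 / real L"
proof (rule real_tendsto_sandwich)
  have bounds: "real N / L - 1 \<le> f N" "f N \<le> real N / L + c" for N
  proof -
    have "real N / L - 1 \<le> real (N div L)"
      using floor_correct[of "real N / real L"] by (simp add: floor_divide_of_nat_eq)
    also have "\<dots> \<le> f N" using assms(2) by simp
    finally show "real N / L - 1 \<le> f N" .
    have "real (f N) \<le> real (N div L) + c" using assms(3)[of N] by linarith
    also have "\<dots> \<le> real N / L + c" using floor_correct[of "real N / real L"] by (simp add: floor_divide_of_nat_eq)
    finally show "f N \<le> real N / L + c" .
  qed
  show "\<forall>\<^sub>F N in sequentially. 1 / real L - 1 / real N \<le> real (f N) / real N"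
    using eventually_gt_at_top[of 0]
  proof eventually_elim
    case (elim N)
    then have "1 / real L - 1 / real N = (real N / L - 1) / real N"
      by (simp add: diff_divide_distrib)
    also have "\<dots> \<le> f N / real N" using bounds(1) elim by (intro divide_right_mono) auto
    finally show ?case .
  qed
  show "\<forall>\<^sub>F N in sequentially. real (f N) / real N \<le> 1 / real L + real c / real N"
    using eventually_gt_at_top[of 0]
  proof eventually_elim
    case (elim N)
    have "f N / real N \<le> (real N / L + c) / real N"
      using bounds(2) elim by (intro divide_right_mono) auto
    also have "\<dots> = 1 / real L + real c / real N" using elim by (simp add: add_divide_distrib)
    finally show ?case .
  qed
  show "(\<lambda>N. 1 / real L - 1 / real N) \<longlonglongrightarrow> 1 / real L"
    using tendsto_diff[OF tendsto_const lim_const_over_n[of "1::real"]] by simp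
  show "(\<lambda>N. 1 / real L + real c / real N) \<longlonglongrightarrow> 1 / real L"
    using tendsto_add[OF tendsto_const lim_const_over_n[of "real c"]] by simp
qed

lemma limit_of_bounded:
  assumes "\<And>N. f N \<le> c"
  shows "(\<lambda>N. real (f N) / real N) \<longlonglongrightarrow> 0"
proof (rule real_tendsto_sandwich[where f = "\<lambda>_. 0" and h = "\<lambda>N. real c / real N"])
  show "\<forall>\<^sub>F N in sequentially. real (f N) / real N \<le> real c / real N"
    using assms by (intro always_eventually allI divide_right_mono) auto
  show "(\<lambda>N. real c / real N) \<longlonglongrightarrow> 0" by (rule lim_const_over_n)
  show "\<forall>\<^sub>F N in sequentially. 0 \<le> real (f N) / real N" by simp
qed (rule tendsto_const)

text \<open>A nonconstant polynomial with positive leading coefficient is eventually increasing because its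
  derivative has a positive leading coefficient, too.\<close>

lemma eventually_negative_or_increasing:
  fixes p :: "real poly"
  assumes "lead_coeff p < 0 \<or> 0 < degree p"
  shows "\<exists>J. (\<forall>j>J. poly p (real j) < 0) \<or>
    (\<forall>j>J. 0 < poly p (real j) \<and> poly p (real j) < poly p (real (j + 1)))"
proof -
  have ev: "\<exists>J. \<forall>x>real J. 0 < poly q x" if q: "0 < lead_coeff q" for q :: "real poly"
  proof -
    obtain a where "\<forall>x\<ge>a. lead_coeff q \<le> poly q x" using poly_pinfty_gt_lc[OF q] by blast
    moreover obtain J where "a < real J" using reals_Archimedean2 by blast
    ultimately have "\<forall>x>real J. lead_coeff q \<le> poly q x" by auto
    then show ?thesis using q by (meson order_less_le_trans)
  qed
  show ?thesis
  proof (cases "lead_coeff p < 0")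
    case True
    then have "0 < lead_coeff (- p)" by simp
    from ev[OF this] obtain J where "\<forall>x>real J. poly p x < 0" by auto
    then show ?thesis by (intro exI[of _ J]) simp
  next
    case False
    then have deg: "0 < degree p" using assms by blast
    then have "lead_coeff p \<noteq> 0" by auto
    with False have lc: "0 < lead_coeff p" by linarith
    have "lead_coeff (pderiv p) = real (degree p) * lead_coeff p"
      using deg by (simp add: degree_pderiv coeff_pderiv)
    then have "0 < lead_coeff (pderiv p)" using lc deg by simp
    from ev[OF this] obtain J1 where J1: "\<forall>x>real J1. 0 < poly (pderiv p) x" by blast
    from ev[OF lc] obtain J2 where J2: "\<forall>x>real J2. 0 < poly p x" by blast
    have "poly p (real j) < poly p (real (j + 1))" if "J1 < j" for j
    proof -
      obtain x where x: "real j < x"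
        "poly p (real (j + 1)) - poly p (real j) = (real (j + 1) - real j) * poly (pderiv p) x"
        using poly_MVT[of "real j" "real (j + 1)" p] by auto
      moreover have "0 < poly (pderiv p) x" using J1 x(1) that by simp
      ultimately show ?thesis by simp
    qed
    then show ?thesis using J2 by (intro exI[of _ "max J1 J2"]) auto
  qed
qed

lemma poly_periodic_imp_constant:
  fixes p :: "real poly"
  assumes "\<And>x. poly p (x + 1) = poly p x"
  shows "degree p = 0"
proof (rule ccontr)
  assume "degree p \<noteq> 0"
  have *: "poly p (real n) = poly p 0" for n
    by (induction n) (use assms in \<open>simp_all add: add.commute[of 1]\<close>)
  have "range real \<subseteq> {x. poly (p - [:poly p 0:]) x = 0}" using * by auto
  moreover have "infinite (range real)" by (simp add: finite_image_iff inj_def)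
  moreover have "p - [:poly p 0:] \<noteq> 0"
    using \<open>degree p \<noteq> 0\<close> by (metis degree_pCons_0 eq_iff_diff_eq_0)
  ultimately show False using poly_roots_finite finite_subset by blast
qed

theorem theorem1p1:
  fixes A B C :: "real poly"
  shows "let
      case1 = (\<forall>x::real. poly A x + poly C (x - 1) = poly B (x - 1) + poly B x);
      case2 =
        ((\<forall>\<^sub>F i :: nat in sequentially.
            poly A (real i) + poly C (real i - 1) < poly B (real i - 1) + poly B (real i)) \<and>
         (\<forall>x::real. poly A (x + 1) - poly A x + poly C x - poly C (x - 1)
            = poly B (x + 1) - poly B (x - 1)))
    in \<exists>H::real.
      (\<lambda>N. real (prevariety_dim N (tropical_solutions A B C N)) / real N) \<longlonglongrightarrow> H \<and>
      (case1 \<longrightarrow> H = 1 / 3) \<and>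
      (case2 \<longrightarrow> H = 1 / 4) \<and>
      (\<not> case1 \<and> \<not> case2 \<longrightarrow> H = 0)"
proof -
  define D where "D = drift A B C"
  define case1 where
    "case1 \<longleftrightarrow> (\<forall>x::real. poly A x + poly C (x - 1) = poly B (x - 1) + poly B x)"
  define case2 where "case2 \<longleftrightarrow>
        ((\<forall>\<^sub>F i :: nat in sequentially.
            poly A (real i) + poly C (real i - 1) < poly B (real i - 1) + poly B (real i)) \<and>
         (\<forall>x::real. poly A (x + 1) - poly A x + poly C x - poly C (x - 1)
            = poly B (x + 1) - poly B (x - 1)))"
  let ?h = "\<lambda>N. real (prevariety_dim N (tropical_solutions A B C N)) / real N"
  have case1: "case1 \<longleftrightarrow> D = 0"
  proof -
    have "case1 \<longleftrightarrow> (\<forall>x. poly D x = 0)"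
      unfolding case1_def D_def poly_drift by (intro iff_allI) linarith
    then show ?thesis by (simp add: poly_all_0_iff_0)
  qed
  have case2: "case2 \<longleftrightarrow> (\<exists>d>0. D = [:d:])"
  proof -
    have "case2 \<longleftrightarrow> (\<forall>\<^sub>F i in sequentially. 0 < poly D (real i)) \<and> (\<forall>x. poly D (x + 1) = poly D x)"
    proof -
      have "poly A (real i) + poly C (real i - 1) < poly B (real i - 1) + poly B (real i)
          \<longleftrightarrow> 0 < poly D (real i)" for i :: nat
        unfolding D_def poly_drift by linarith
      moreover have "poly A (x + 1) - poly A x + poly C x - poly C (x - 1)
            = poly B (x + 1) - poly B (x - 1) \<longleftrightarrow> poly D (x + 1) = poly D x" for x
        unfolding D_def poly_drift by auto
      ultimately show ?thesis unfolding case2_def by presburger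
    qed
    also have "\<dots> \<longleftrightarrow> (\<exists>d>0. D = [:d:])"
    proof
      assume *: "(\<forall>\<^sub>F i in sequentially. 0 < poly D (real i)) \<and> (\<forall>x. poly D (x + 1) = poly D x)"
      then have "degree D = 0" by (intro poly_periodic_imp_constant) auto
      then obtain d where "D = [:d:]" by (rule degree_eq_zeroE)
      then show "\<exists>d>0. D = [:d:]" using * by (auto simp: eventually_sequentially)
    qed auto
    finally show ?thesis .
  qed
  consider (zero) "D = 0" | (pos) d where "0 < d" "D = [:d:]"
    | (other) "lead_coeff D < 0 \<or> 0 < degree D"
  proof (cases "degree D = 0")
    case True
    then obtain d where "D = [:d:]" by (rule degree_eq_zeroE)
    then show thesis using that by (cases d "0::real" rule: linorder_cases) auto
  qed (use that in auto)
  then have "\<exists>H. ?h \<longlonglongrightarrow> H \<and> (case1 \<longrightarrow> H = 1 / 3) \<and> (case2 \<longrightarrow> H = 1 / 4) \<and>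
      (\<not> case1 \<and> \<not> case2 \<longrightarrow> H = 0)"
  proof cases
    case zero
    then have "?h \<longlonglongrightarrow> 1 / real 3"
      using prevariety_dim_ge_zero_drift[of A B C] prevariety_dim_le_zero_drift[of A B C]
      by (intro limit_of_linear_growth) (auto simp: D_def)
    moreover have "case1" "\<not> case2" using zero case1 case2 by auto
    ultimately show ?thesis by auto
  next
    case pos
    then have "poly (drift A B C) (real j) = d" for j by (simp add: D_def)
    then have "?h \<longlonglongrightarrow> 1 / real 4"
      using prevariety_dim_ge_positive_drift[of A B C d] pos(1)
        prevariety_dim_le_positive_drift[of A B C d]
      by (intro limit_of_linear_growth) auto
    moreover have "\<not> case1" "case2" using pos case1 case2 by auto
    ultimately show ?thesis by auto
  next
    case other
    then obtain J where "(\<forall>j>J. poly D (real j) < 0) \<or>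
        (\<forall>j>J. 0 < poly D (real j) \<and> poly D (real j) < poly D (real (j + 1)))"
      using eventually_negative_or_increasing by blast
    then have "?h \<longlonglongrightarrow> 0"
      unfolding D_def by (intro limit_of_bounded[where c = "J + 3"] prevariety_dim_bounded)
    moreover have "\<not> case1" "\<not> case2" using other case1 case2 by auto
    ultimately show ?thesis by auto
  qed
  then show ?thesis unfolding case1_def case2_def Let_def .
qed

end
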